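(* Let $B$ be a finite bidirected graph and let $X,Y$ be sets of vertices of $B$ such that there is no nontrivial path in $B$ with both endpoints in $X$. Then the maximum number of pairwise vertex-disjoint $X$--$Y$ paths in $B$ is equal to $$\min\left\{\left|\epsilon_{X,B}(W)\right| : Y\subseteq W\subseteq V(B)\right\}.$$
   Context: A bidirected graph $B=(G,\sigma)$ is a loopless multigraph $G$ together with a map $\sigma$ assigning to each half-edge $(e,u)$ ($u$ an endpoint of the edge $e$) a sign $\sigma(e,u)\in\{+,-\}$. A path in $B$ is a sequence $v_0e_1v_1\dots e_\ell v_\ell$ of pairwise distinct vertices $v_i$ and edges $e_i$, where $e_i$ joins $v_{i-1}$ and $v_i$ and $\sigma(e_{i+1},v_i)=-\sigma(e_i,v_i)$ for $1\le i<\ell$; it is trivial if $\ell=0$. For sets $X,Y$ of vertices, a path $P$ is an $X$--$Y$ path if its first vertex is the unique vertex of $P$ in $X$ and its last vertex is the unique vertex of $P$ in $Y$ (trivial paths are allowed). $\epsilon_{X,B}(W)$ is the set of vertices $v\in W$ for which there is an $X$--$\{v\}$ path that is either trivial or whose second to last vertex is not in $W$. *)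

theory Defs
  imports Main
begin

datatype sign = Plus | Minus

fun opposite :: "sign \<Rightarrow> sign" where
  "opposite Plus = Minus"
| "opposite Minus = Plus"

text \<open>
  Multigraphs have an explicit carrier of edges, so parallel edges are distinct elements of
  type \<open>'e\<close> with the same set of endpoints.  The value \<open>half_sign B e u\<close> is meaningful only if
  \<open>e\<close> is an edge and \<open>u\<close> is one of its endpoints; all other values are irrelevant.
\<close>

record ('v, 'e) bidigraph =
  verts :: "'v set"
  edges :: "'e set"
  ends :: "'e \<Rightarrow> 'v set"
  half_sign :: "'e \<Rightarrow> 'v \<Rightarrow> sign"

definition bidirected_graph :: "('v, 'e) bidigraph \<Rightarrow> bool" where
  "bidirected_graph B \<longleftrightarrow> (\<forall>e \<in> edges B. ends B e \<subseteq> verts B \<and> card (ends B e) = 2)"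

definition finite_bidirected_graph :: "('v, 'e) bidigraph \<Rightarrow> bool" where
  "finite_bidirected_graph B \<longleftrightarrow>
     bidirected_graph B \<and> finite (verts B) \<and> finite (edges B)"

text \<open>
  The sequence \<open>v\<^sub>0 e\<^sub>1 v\<^sub>1 \<dots> e\<^sub>l v\<^sub>l\<close> is the pair of lists \<open>([v\<^sub>0, \<dots>, v\<^sub>l], [e\<^sub>1, \<dots>, e\<^sub>l])\<close>.
  List positions start at 0, so \<open>es ! i\<close> is the edge with index \<open>i + 1\<close>.
\<close>

type_synonym ('v, 'e) walk = "'v list \<times> 'e list"

definition is_path :: "('v, 'e) bidigraph \<Rightarrow> ('v, 'e) walk \<Rightarrow> bool" where
  "is_path B = (\<lambda>(vs, es).
     length vs = Suc (length es) \<and>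
     set vs \<subseteq> verts B \<and> set es \<subseteq> edges B \<and>
     distinct vs \<and> distinct es \<and>
     (\<forall>i < length es. ends B (es ! i) = {vs ! i, vs ! Suc i}) \<and>
     (\<forall>i. Suc i < length es \<longrightarrow>
        half_sign B (es ! Suc i) (vs ! Suc i) = opposite (half_sign B (es ! i) (vs ! Suc i))))"

definition trivial_path :: "('v, 'e) walk \<Rightarrow> bool" where
  "trivial_path P \<longleftrightarrow> length (snd P) = 0"

definition path_verts :: "('v, 'e) walk \<Rightarrow> 'v set" where
  "path_verts P = set (fst P)"

definition first_vert :: "('v, 'e) walk \<Rightarrow> 'v" where
  "first_vert P = hd (fst P)"

definition last_vert :: "('v, 'e) walk \<Rightarrow> 'v" where
  "last_vert P = last (fst P)"

text \<open>Only meaningful for nontrivial paths.\<close>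

definition second_to_last_vert :: "('v, 'e) walk \<Rightarrow> 'v" where
  "second_to_last_vert P = last (butlast (fst P))"

definition set_path :: "('v, 'e) bidigraph \<Rightarrow> 'v set \<Rightarrow> 'v set \<Rightarrow> ('v, 'e) walk \<Rightarrow> bool" where
  "set_path B X Y P \<longleftrightarrow>
     is_path B P \<and>
     path_verts P \<inter> X = {first_vert P} \<and>
     path_verts P \<inter> Y = {last_vert P}"

definition disjoint_set_paths ::
    "('v, 'e) bidigraph \<Rightarrow> 'v set \<Rightarrow> 'v set \<Rightarrow> ('v, 'e) walk set \<Rightarrow> bool" where
  "disjoint_set_paths B X Y \<P> \<longleftrightarrow>
     (\<forall>P \<in> \<P>. set_path B X Y P) \<and>
     (\<forall>P \<in> \<P>. \<forall>Q \<in> \<P>. P \<noteq> Q \<longrightarrow> path_verts P \<inter> path_verts Q = {})"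

text \<open>
  A witnessing path may meet \<open>W\<close> before its end; only its second to last vertex is constrained.
\<close>

definition epsilon :: "'v set \<Rightarrow> ('v, 'e) bidigraph \<Rightarrow> 'v set \<Rightarrow> 'v set" where
  "epsilon X B W =
     {v \<in> W. \<exists>P. set_path B X {v} P \<and> (trivial_path P \<or> second_to_last_vert P \<notin> W)}"

end

theory Submission
  imports Defs
begin

text \<open>
  Replace every vertex \<open>v\<close> outside \<open>X\<close> by two nodes \<open>(v, Plus)\<close>, \<open>(v, Minus)\<close> that are matched to each
  other, and every vertex of \<open>X\<close> by one unmatched node.  Paths starting in \<open>X\<close> become alternating
  paths, and the hypothesis on \<open>X\<close> says that there is no augmenting path, so that this matching is
  maximum.  Disjoint \<open>X\<close>--\<open>Y\<close> paths are obtained from the symmetric difference with a maximum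
  matching \<open>q\<close> that leaves as many nodes over \<open>Y\<close> exposed as possible, say those in \<open>T\<close>.

  The sets exposed by maximum matchings are the bases of a matroid, in which adjacent nodes that can
  both be exposed are parallel.  The set \<open>W\<close> attaining the minimum consists of the vertices whose
  nodes all lie in the closure of \<open>T\<close>.  An element of \<open>\<epsilon>(W)\<close> is a place where one of the
  alternating paths of the symmetric difference enters the closure, and no such path can leave it
  again, so distinct elements of \<open>\<epsilon>(W)\<close> lead to distinct ends in \<open>T\<close>.
\<close>

subsection \<open>Maximum matchings and alternating walks\<close>

text \<open>
  A matching is represented as an involution on the whole type whose fixed points are the exposed
  vertices.
\<close>

locale matching_graph =
  fixes V :: "'a set" and adj :: "'a \<Rightarrow> 'a \<Rightarrow> bool"
  assumes finite_V: "finite V"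
    and adj_V: "adj u v \<Longrightarrow> u \<in> V"
    and adj_sym: "adj u v \<Longrightarrow> adj v u"
    and adj_irrefl: "\<not> adj v v"
begin

definition matching :: "('a \<Rightarrow> 'a) \<Rightarrow> bool" where
  "matching m \<longleftrightarrow> (\<forall>v. m (m v) = v \<and> (m v \<noteq> v \<longrightarrow> adj v (m v)))"

definition exposed :: "('a \<Rightarrow> 'a) \<Rightarrow> 'a set" where
  "exposed m = {v \<in> V. m v = v}"

definition maximum :: "('a \<Rightarrow> 'a) \<Rightarrow> bool" where
  "maximum m \<longleftrightarrow> matching m \<and> (\<forall>m'. matching m' \<longrightarrow> card (exposed m) \<le> card (exposed m'))"

text \<open>One step crosses a \<open>q\<close>-edge and then a \<open>p\<close>-edge, so the index
  counts only the even vertices of the alternating walk; the odd ones are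
  \<open>q (walk p q x i)\<close>.\<close>

definition walk :: "('a \<Rightarrow> 'a) \<Rightarrow> ('a \<Rightarrow> 'a) \<Rightarrow> 'a \<Rightarrow> nat \<Rightarrow> 'a" where
  "walk p q x i = ((p \<circ> q) ^^ i) x"

definition visited :: "('a \<Rightarrow> 'a) \<Rightarrow> ('a \<Rightarrow> 'a) \<Rightarrow> 'a \<Rightarrow> nat \<Rightarrow> 'a set" where
  "visited p q x i = (\<Union>j<i. {walk p q x j, q (walk p q x j)})"

definition trail :: "('a \<Rightarrow> 'a) \<Rightarrow> ('a \<Rightarrow> 'a) \<Rightarrow> 'a \<Rightarrow> nat \<Rightarrow> 'a set" where
  "trail p q x i = insert (walk p q x i) (visited p q x i)"

text \<open>The first disjunct is an end at a \<open>q\<close>-exposed vertex. The second is an end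
  at a \<open>p\<close>-exposed odd vertex, which makes a walk from a \<open>p\<close>-exposed start
  augmenting for \<open>p\<close>.\<close>

definition stops :: "('a \<Rightarrow> 'a) \<Rightarrow> ('a \<Rightarrow> 'a) \<Rightarrow> 'a \<Rightarrow> nat \<Rightarrow> bool" where
  "stops p q x i \<longleftrightarrow> q (walk p q x i) = walk p q x i \<or>
     p (q (walk p q x i)) = q (walk p q x i)"

definition len :: "('a \<Rightarrow> 'a) \<Rightarrow> ('a \<Rightarrow> 'a) \<Rightarrow> 'a \<Rightarrow> nat" where
  "len p q x = (LEAST i. stops p q x i)"

definition final :: "('a \<Rightarrow> 'a) \<Rightarrow> ('a \<Rightarrow> 'a) \<Rightarrow> 'a \<Rightarrow> 'a" where
  "final p q x = walk p q x (len p q x)"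

text \<open>For a walk that ends at a \<open>q\<close>-exposed vertex this is a whole component of
  the union of \<open>p\<close> and \<open>q\<close>. For an augmenting walk the odd end vertex is
  left out.\<close>

definition component :: "('a \<Rightarrow> 'a) \<Rightarrow> ('a \<Rightarrow> 'a) \<Rightarrow> 'a \<Rightarrow> 'a set" where
  "component p q x = trail p q x (len p q x)"

lemma matching_involution: "matching m \<Longrightarrow> m (m v) = v"
  by (simp add: matching_def)

lemma matching_adj: "matching m \<Longrightarrow> m v \<noteq> v \<Longrightarrow> adj v (m v)"
  by (simp add: matching_def)

lemma matching_V: "matching m \<Longrightarrow> v \<in> V \<Longrightarrow> m v \<in> V"
  by (metis matching_def adj_V adj_sym)

lemma maximum_matching: "maximum m \<Longrightarrow> matching m"
  by (simp add: maximum_def)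

lemma finite_exposed: "finite (exposed m)"
  by (simp add: exposed_def finite_V)

lemma maximum_card: "maximum m \<Longrightarrow> maximum m' \<Longrightarrow> card (exposed m) = card (exposed m')"
  by (simp add: maximum_def le_antisym)

lemma maximum_if_card_le:
  "maximum m \<Longrightarrow> matching m' \<Longrightarrow> card (exposed m') \<le> card (exposed m) \<Longrightarrow> maximum m'"
  by (meson maximum_def order_trans)

text \<open>The symmetric difference construction: by closure of \<open>C\<close>, no edge of either
  matching crosses its border.\<close>

lemma matching_switch:
  assumes "matching m" "matching m'"
    and "\<And>v. v \<in> C \<Longrightarrow> m v \<in> C" "\<And>v. v \<in> C \<Longrightarrow> m' v \<in> C"
  shows "matching (\<lambda>v. if v \<in> C then m' v else m v)"
  unfolding matching_def
proof (intro allI)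
  fix v
  have "m v \<in> C \<longleftrightarrow> v \<in> C" using assms(1,3) by (metis matching_involution)
  then show "(if (if v \<in> C then m' v else m v) \<in> C then m' (if v \<in> C then m' v else m v)
      else m (if v \<in> C then m' v else m v)) = v \<and>
    ((if v \<in> C then m' v else m v) \<noteq> v \<longrightarrow> adj v (if v \<in> C then m' v else m v))"
    using assms(1,2,4) by (simp add: matching_def)
qed

text \<open>If \<open>l\<close> were exposed, the edge from \<open>u\<close> to \<open>l\<close>
  could be added. So \<open>l\<close> is matched, and trading its edge for the one from
  \<open>u\<close> exposes \<open>m l\<close> in place of \<open>u\<close>.\<close>

lemma maximum_rotate:
  assumes m: "maximum m" and u: "m u = u" and ul: "adj u l"
  shows "m l \<noteq> l" "maximum (m(u := l, l := u, m l := m l))"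
proof -
  have mm: "matching m" using m by (rule maximum_matching)
  have ne: "u \<noteq> l" using ul adj_irrefl by auto
  have uV: "u \<in> V" "l \<in> V" using ul adj_V adj_sym by blast+
  show l: "m l \<noteq> l"
  proof
    assume l: "m l = l"
    let ?m = "m(u := l, l := u)"
    have "matching ?m" using mm u l ul ne adj_sym[OF ul] unfolding matching_def by (simp, metis)
    moreover have "exposed ?m = exposed m - {u, l}" using ne by (auto simp: exposed_def)
    moreover have "u \<in> exposed m" using u uV by (simp add: exposed_def)
    ultimately show False using m unfolding maximum_def
      by (metis Diff_iff finite_exposed insertI1 leD psubset_card_mono psubsetI Diff_subset)
  qed
  let ?m = "m(u := l, l := u, m l := m l)"
  have mlu: "m l \<noteq> u" using u ne mm by (metis matching_involution)
  have "matching ?m" using mm u l mlu ul ne adj_sym[OF ul] unfolding matching_def by (simp, metis)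
  have "exposed ?m \<subseteq> insert (m l) (exposed m - {u})"
    using ne mlu l by (auto simp: exposed_def)
  then have "card (exposed ?m) \<le> card (insert (m l) (exposed m - {u}))"
    by (intro card_mono) (simp_all add: finite_exposed)
  moreover have "card (insert (m l) (exposed m - {u})) \<le> Suc (card (exposed m - {u}))"
    by (simp add: card_insert_if finite_exposed)
  moreover have "Suc (card (exposed m - {u})) = card (exposed m)"
    using u uV by (intro card_Suc_Diff1 finite_exposed) (simp add: exposed_def)
  ultimately have "card (exposed ?m) \<le> card (exposed m)" by linarith
  with \<open>matching ?m\<close> show "maximum ?m" using m maximum_if_card_le by blast
qed

section \<open>The alternating walk from a vertex exposed by \<open>p\<close>\<close>

context
  fixes p q :: "'a \<Rightarrow> 'a" and x :: 'a
  assumes p: "matching p" and q: "matching q" and xV: "x \<in> V" and px: "p x = x"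
begin

abbreviation (input) "c \<equiv> walk p q x"

lemma walk_0 [simp]: "walk p q x 0 = x" by (simp add: walk_def)

lemma walk_Suc: "c (Suc i) = p (q (c i))" by (simp add: walk_def)

lemma p_walk_Suc: "p (c (Suc i)) = q (c i)"
  using p by (simp add: walk_Suc matching_involution)

lemma walk_V: "c i \<in> V"
  by (induction i) (simp_all add: xV walk_Suc p q matching_V)

lemma trail_iff: "v \<in> trail p q x i \<longleftrightarrow> (\<exists>j\<le>i. v = c j) \<or> (\<exists>j<i. v = q (c j))"
  unfolding trail_def visited_def by (simp add: le_less) blast

lemma walk_in_trail: "j \<le> i \<Longrightarrow> c j \<in> trail p q x i"
  by (cases "j = i") (auto simp: trail_def visited_def)

lemma q_walk_in_visited: "j < i \<Longrightarrow> q (c j) \<in> visited p q x i"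
  by (auto simp: visited_def)

lemma visited_closed: "v \<in> visited p q x i \<Longrightarrow> q v \<in> visited p q x i"
  using q by (auto simp: visited_def matching_involution)

lemma trail_closed: "v \<in> trail p q x i \<Longrightarrow> p v \<in> trail p q x i"
proof -
  have *: "p (c j) \<in> trail p q x i" if "j \<le> i" for j
  proof (cases j)
    case 0 then show ?thesis using px walk_in_trail[of 0 i] by simp
  next
    case (Suc k)
    then show ?thesis using that q_walk_in_visited[of k i] by (simp add: p_walk_Suc trail_def)
  qed
  have "p (q (c j)) \<in> trail p q x i" if "j < i" for j
    using that walk_in_trail[of "Suc j" i] by (simp add: walk_Suc)
  moreover assume "v \<in> trail p q x i"
  then consider j where "j \<le> i" "v = c j" | j where "j < i" "v = q (c j)"
    unfolding trail_iff by blast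
  ultimately show "p v \<in> trail p q x i" using * by cases auto
qed

lemma q_walk_fresh_aux:
  assumes "c i \<notin> visited p q x i" "q (c i) \<noteq> c i"
  shows "q (c i) \<notin> trail p q x i"
  using assms visited_closed[of "q (c i)" i] q by (auto simp: trail_def matching_involution)

text \<open>Visited pairs are closed under \<open>q\<close>, so a new \<open>q\<close>-partner lies
  off the trail. The trail is closed under \<open>p\<close>, so the \<open>p\<close>-partner of that
  vertex, distinct from it because the walk has not stopped, is new as well.\<close>

lemma walk_fresh: "\<forall>j<i. \<not> stops p q x j \<Longrightarrow> c i \<notin> visited p q x i"
proof (induction i rule: less_induct)
  case (less i)
  show ?case
  proof (cases i)
    case 0 then show ?thesis by (simp add: visited_def)
  next
    case (Suc k)
    have ns: "\<not> stops p q x k" using less.prems Suc by simp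
    have bk: "q (c k) \<notin> trail p q x k"
      using less ns Suc by (intro q_walk_fresh_aux) (auto simp: stops_def)
    have "p (q (c k)) \<noteq> q (c k)" using ns by (simp add: stops_def)
    moreover have "p (q (c k)) \<notin> trail p q x k"
      using bk trail_closed[of "p (q (c k))" k] p by (auto simp: matching_involution)
    moreover have "visited p q x i = insert (q (c k)) (trail p q x k)"
      by (auto simp: Suc visited_def trail_def lessThan_Suc)
    ultimately show ?thesis by (simp add: Suc walk_Suc)
  qed
qed

lemma q_walk_fresh:
  "\<forall>j<i. \<not> stops p q x j \<Longrightarrow> q (c i) \<noteq> c i \<Longrightarrow> q (c i) \<notin> trail p q x i"
  by (simp add: q_walk_fresh_aux walk_fresh)

lemma trail_p_fixed:
  assumes "\<forall>j<i. \<not> stops p q x j" "v \<in> trail p q x i" "p v = v"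
  shows "v = x"
proof -
  have *: "p (q (c j)) \<noteq> q (c j)" if "j < i" for j using assms(1) that by (simp add: stops_def)
  have "c j = x" if "p (c j) = c j" "j \<le> i" for j
  proof (cases j)
    case (Suc k)
    then show ?thesis using that *[of k] p_walk_Suc[of k] by (simp add: walk_Suc)
  qed simp
  then show ?thesis using assms(2,3) * by (auto simp: trail_def visited_def less_imp_le)
qed

lemma visited_q_not_fixed:
  assumes "\<forall>j<i. \<not> stops p q x j" "v \<in> visited p q x i"
  shows "q v \<noteq> v"
  using assms q by (auto simp: visited_def stops_def matching_involution)

lemma stops_ex: "\<exists>i. stops p q x i"
proof (rule ccontr)
  assume "\<not> ?thesis"
  then have "c i \<notin> visited p q x i" for i using walk_fresh by blast
  then have "c j \<noteq> c i" if "i < j" for i j using that by (fastforce simp: visited_def)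
  then have "inj c" by (metis injI linorder_neqE_nat)
  moreover have "range c \<subseteq> V" using walk_V by auto
  ultimately show False using finite_V
    by (metis finite_imageD finite_subset infinite_UNIV_nat)
qed

lemma stops_len: "stops p q x (len p q x)"
  unfolding len_def using stops_ex by (rule LeastI_ex)

lemma not_stops: "\<forall>j<len p q x. \<not> stops p q x j"
  unfolding len_def using not_less_Least by blast

lemma final_V: "final p q x \<in> V"
  by (simp add: final_def walk_V)

lemma start_in_component: "x \<in> component p q x"
  using walk_in_trail[of 0 "len p q x"] by (simp add: component_def)

lemma component_p_closed: "v \<in> component p q x \<Longrightarrow> p v \<in> component p q x"
  by (simp add: component_def trail_closed)

lemma component_p_fixed: "v \<in> component p q x \<Longrightarrow> p v = v \<Longrightarrow> v = x"
  using trail_p_fixed not_stops by (auto simp: component_def)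

lemma component_cases:
  assumes "v \<in> component p q x"
  obtains i where "i \<le> len p q x" "v = c i" | i where "i < len p q x" "v = q (c i)"
  using assms unfolding component_def trail_iff by blast

lemma component_q_closed:
  "q (final p q x) = final p q x \<Longrightarrow> v \<in> component p q x \<Longrightarrow> q v \<in> component p q x"
  by (auto simp: component_def final_def trail_def visited_closed)

lemma component_q_fixed:
  assumes "v \<in> component p q x" "q v = v"
  shows "v = final p q x"
  using assms visited_q_not_fixed[OF not_stops] by (auto simp: component_def final_def trail_def)

lemma walk_closed_back:
  assumes "c i \<in> C" "\<And>v. v \<in> C \<Longrightarrow> p v \<in> C" "\<And>v. v \<in> C \<Longrightarrow> q v \<in> C"
  shows "x \<in> C"
  using assms(1)
proof (induction i)
  case (Suc i)
  then show ?case using assms(2,3) by (metis p_walk_Suc matching_involution q)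
qed simp

end

text \<open>From a common vertex one walk can be followed back to its start inside the component of
  the other, whose only \<open>p\<close>-exposed vertex is \<open>y\<close>.\<close>

lemma component_disjoint:
  assumes p: "matching p" and q: "matching q"
    and x: "x \<in> exposed p" and y: "y \<in> exposed p"
    and fx: "q (final p q x) = final p q x" and fy: "q (final p q y) = final p q y"
    and v: "v \<in> component p q x" "v \<in> component p q y"
  shows "x = y"
proof -
  have x': "x \<in> V" "p x = x" and y': "y \<in> V" "p y = y" using x y by (auto simp: exposed_def)
  note cl = component_p_closed[OF p q y'] component_q_closed[OF p q y' fy]
  have "\<exists>i. walk p q x i \<in> component p q y"
    using v(1) by (rule component_cases[OF p q x'])
      (use v(2) cl in \<open>auto, metis matching_involution q\<close>)
  then have "x \<in> component p q y" using walk_closed_back[OF p q x'] cl by blast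
  then show ?thesis using component_p_fixed[OF p q y' _ x'(2)] by simp
qed

lemma final_inj:
  assumes "matching p" "matching q"
    and "\<And>x. x \<in> E \<Longrightarrow> q (final p q x) = final p q x" "E \<subseteq> exposed p"
  shows "inj_on (final p q) E"
proof (rule inj_onI)
  fix x y assume *: "x \<in> E" "y \<in> E" "final p q x = final p q y"
  have "final p q z \<in> component p q z" for z by (simp add: component_def final_def trail_def)
  with * show "x = y" using component_disjoint[OF assms(1,2), of x y "final p q x"] assms(3,4)
    by (metis subsetD)
qed

text \<open>The counting half of Berge's theorem: if no walk augments, the walks inject the vertices
  exposed by \<open>p\<close> into those exposed by \<open>q\<close>.\<close>

lemma card_exposed_le:
  assumes "matching p" "matching q"
    and "\<And>x. x \<in> exposed p \<Longrightarrow> q (final p q x) = final p q x"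
  shows "card (exposed p) \<le> card (exposed q)"
proof -
  have "final p q ` exposed p \<subseteq> exposed q"
    using assms final_V by (auto simp: exposed_def)
  then show ?thesis using final_inj[OF assms(1,2), of "exposed p"] assms(3)
    by (metis card_inj_on_le finite_exposed order_refl)
qed

section \<open>Walks that start from a maximum matching\<close>

context
  fixes p q :: "'a \<Rightarrow> 'a" and x :: 'a
  assumes pmax: "maximum p" and q: "matching q" and xV: "x \<in> V" and px: "p x = x"
begin

lemma p_match: "matching p" using pmax by (rule maximum_matching)

text \<open>Otherwise the walk is an augmenting path, and switching \<open>p\<close> along it would
  expose fewer vertices.\<close>

lemma final_q_fixed: "q (final p q x) = final p q x"
proof (rule ccontr)
  note [simp] = p_match q xV px
  assume ne: "q (final p q x) \<noteq> final p q x"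
  \<comment> \<open>Going up to \<open>Suc\<close> of the length adds the odd end vertex that
    \<open>component\<close> omits, which makes the set closed under \<open>q\<close>.\<close>
  let ?n = "len p q x" and ?C = "visited p q x (Suc (len p q x))"
  have pq: "p (q (final p q x)) = q (final p q x)"
    using ne stops_len[of p q x] by (auto simp: final_def stops_def)
  have C: "?C = insert (q (final p q x)) (component p q x)"
    by (auto simp: visited_def component_def final_def trail_def lessThan_Suc)
  let ?m = "\<lambda>v. if v \<in> ?C then q v else p v"
  have "matching ?m"
  proof (rule matching_switch)
    show "p v \<in> ?C" if "v \<in> ?C" for v using that pq component_p_closed[of p q x v] by (auto simp: C)
  qed (simp_all add: visited_closed)
  moreover have "exposed ?m \<subset> exposed p"
  proof -
    have "q v \<noteq> v" if "v \<in> ?C" for v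
      using that[unfolded C insert_iff]
    proof
      assume "v = q (final p q x)" then show ?thesis using ne by (metis matching_involution[OF q])
    next
      assume "v \<in> component p q x" then show ?thesis using ne component_q_fixed[OF p_match q xV px, of v] by metis
    qed
    then have "v \<in> exposed p \<and> v \<notin> ?C" if "v \<in> exposed ?m" for v
      using that unfolding exposed_def by (metis (mono_tags, lifting) mem_Collect_eq)
    moreover have "x \<in> ?C" using start_in_component[OF p_match q xV px] unfolding C by blast
    moreover have "x \<in> exposed p" using px xV by (simp add: exposed_def)
    ultimately show ?thesis by blast
  qed
  ultimately show False
    using pmax finite_exposed[of p] unfolding maximum_def by (meson leD psubset_card_mono)
qed

text \<open>Each rotation moves the exposed vertex one step along the walk. Agreement with
  \<open>p\<close> off the trail is the invariant that makes the next rotation release the next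
  vertex of the walk; later it also keeps other exposed vertices exposed.\<close>

lemma walk_exposable:
  assumes "i \<le> len p q x"
  shows "\<exists>n. maximum n \<and> n (walk p q x i) = walk p q x i \<and>
    (\<forall>v. v \<notin> trail p q x i \<longrightarrow> n v = p v)"
  using assms
proof (induction i)
  note [simp] = p_match q xV px
  case 0
  then show ?case using pmax by auto
next
  note [simp] = p_match q xV px
  case (Suc i)
  let ?c = "walk p q x i" and ?b = "q (walk p q x i)"
  obtain n where n: "maximum n" "n ?c = ?c" "\<forall>v. v \<notin> trail p q x i \<longrightarrow> n v = p v"
    using Suc by auto
  have ns: "\<forall>j<i. \<not> stops p q x j" "\<not> stops p q x i"
    using Suc not_stops[of p q x] by auto
  have ne: "?b \<noteq> ?c" using ns by (auto simp: stops_def)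
  then have fresh: "?b \<notin> trail p q x i" using q_walk_fresh[of p q x i] ns by auto
  then have nb: "n ?b = walk p q x (Suc i)" using n by (simp add: walk_Suc)
  have "adj ?c ?b" using ne q matching_adj by metis
  from maximum_rotate[OF n(1,2) this] nb
  have max: "maximum (n(?c := ?b, ?b := ?c, walk p q x (Suc i) := walk p q x (Suc i)))" by simp
  have tr: "trail p q x (Suc i) = insert (walk p q x (Suc i)) (insert ?b (trail p q x i))"
    by (auto simp: trail_def visited_def lessThan_Suc)
  show ?case
    by (rule exI, rule conjI, rule max) (use n(3) walk_in_trail[of p q x i i] in \<open>auto simp: tr\<close>)
qed

end

text \<open>The basis exchange of the matroid: replacing \<open>q\<close> by \<open>p\<close> on one
  component trades its \<open>q\<close>-exposed end for its \<open>p\<close>-exposed end.\<close>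

lemma maximum_switch_component:
  fixes p q :: "'a \<Rightarrow> 'a"
  assumes p: "maximum p" and q: "maximum q" and x: "x \<in> exposed p"
  defines "m \<equiv> \<lambda>v. if v \<in> component p q x then p v else q v"
  shows "maximum m" "exposed m = insert x (exposed q - {final p q x})"
proof -
  note x' = x[unfolded exposed_def, simplified, THEN conjunct1] x[unfolded exposed_def, simplified, THEN conjunct2]
  note mp = maximum_matching[OF p] and mq = maximum_matching[OF q]
  note fx = final_q_fixed[OF p mq x']
  have fin: "final p q x \<in> component p q x" by (simp add: component_def final_def trail_def)
  show ex: "exposed m = insert x (exposed q - {final p q x})"
  proof (rule set_eqI)
    fix v
    show "v \<in> exposed m \<longleftrightarrow> v \<in> insert x (exposed q - {final p q x})"
    proof (cases "v \<in> component p q x")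
      case True
      have "p v = v \<longleftrightarrow> v = x" using component_p_fixed[OF mp mq x' True] x' by blast
      moreover have "q v = v \<longrightarrow> v = final p q x" using component_q_fixed[OF mp mq x' True] by blast
      ultimately show ?thesis using True x' by (auto simp: exposed_def m_def)
    next
      case False
      then have "v \<noteq> x" "v \<noteq> final p q x" using fin start_in_component[OF mp mq x'] by blast+
      then show ?thesis using False by (simp add: exposed_def m_def)
    qed
  qed
  have "matching m" unfolding m_def
    using mp mq component_p_closed[OF mp mq x'] component_q_closed[OF mp mq x' fx]
    by (intro matching_switch) auto
  moreover have "card (exposed m) \<le> Suc (card (exposed q - {final p q x}))"
    unfolding ex by (simp add: card_insert_if finite_exposed)
  moreover have "Suc (card (exposed q - {final p q x})) = card (exposed q)"
    using fx final_V[OF mp mq x'] by (intro card_Suc_Diff1 finite_exposed) (simp add: exposed_def)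
  ultimately show "maximum m" using maximum_if_card_le[OF q] by simp
qed

section \<open>Closure in the matroid of exposed sets\<close>

text \<open>The complement of the closure of \<open>T\<close>, for \<open>T\<close> independent in the matroid of exposed sets.\<close>

definition reach :: "'a set \<Rightarrow> 'a set" where
  "reach T = {z \<in> V - T. \<exists>n. maximum n \<and> insert z T \<subseteq> exposed n}"

text \<open>Adjacent vertices are never exposed together by a maximum matching. So when a component
  switch brings in \<open>v\<close>, the vertex it displaces must be \<open>u\<close>, and
  \<open>T\<close> survives. In matroid terms \<open>u\<close> and \<open>v\<close> are
  parallel.\<close>

lemma reach_neighbour:
  assumes "u \<in> reach T" "adj u v" "maximum n" "n v = v"
  shows "v \<in> reach T"
proof -
  obtain q where q: "maximum q" "insert u T \<subseteq> exposed q" and u: "u \<notin> T"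
    using assms(1) by (auto simp: reach_def)
  have v: "v \<in> exposed n" using assms(2,4) adj_V adj_sym by (auto simp: exposed_def)
  have vq: "q v \<noteq> v" using maximum_rotate(1)[OF q(1), of u v] q(2) assms(2) by (auto simp: exposed_def)
  then have vT: "v \<notin> T" using q(2) by (auto simp: exposed_def)
  note sw = maximum_switch_component[OF assms(3) q(1) v]
  let ?m = "\<lambda>w. if w \<in> component n q v then n w else q w"
  have "final n q v = u"
  proof (rule ccontr)
    assume "final n q v \<noteq> u"
    then have "u \<in> exposed ?m" "v \<in> exposed ?m" using sw(2) q(2) by auto
    then show False using maximum_rotate(1)[OF sw(1), of u v] assms(2) by (simp add: exposed_def)
  qed
  then have "insert v T \<subseteq> exposed ?m" using sw(2) q(2) u by auto
  then show ?thesis using sw(1) v vT by (auto simp: reach_def exposed_def)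
qed

text \<open>Rotations change \<open>p\<close> only on the trail, whose single
  \<open>p\<close>-exposed vertex is \<open>u\<close>, so \<open>T\<close> stays exposed while the
  walk is followed.\<close>

lemma walk_in_reach:
  assumes p: "maximum p" "insert u T \<subseteq> exposed p" "u \<notin> T" and q: "matching q"
    and i: "i \<le> len p q u"
  shows "walk p q u i \<in> reach T"
proof -
  have u: "u \<in> V" "p u = u" using p by (auto simp: exposed_def)
  note mp = maximum_matching[OF p(1)]
  obtain n where n: "maximum n" "n (walk p q u i) = walk p q u i"
    "\<forall>v. v \<notin> trail p q u i \<longrightarrow> n v = p v"
    using walk_exposable[OF p(1) q u i] by blast
  have ns: "\<forall>j<i. \<not> stops p q u j" using not_stops[OF mp q u] i by simp
  have T: "v \<notin> trail p q u i" if "v \<in> T" for v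
    using trail_p_fixed[OF mp q u ns, of v] that p by (auto simp: exposed_def)
  have "walk p q u i \<notin> T" using T walk_in_trail[OF mp q u order_refl] by blast
  then show ?thesis using n T p(2) walk_V[OF mp q u]
    by (auto simp: reach_def exposed_def intro!: exI[of _ n])
qed

text \<open>Either \<open>l\<close> is an odd vertex of the walk from \<open>u\<close>, so that
  \<open>n\<close> matches it to an even one, or \<open>l\<close> is untouched when the component of
  \<open>u\<close> is switched into \<open>n\<close>, and rotating along the edge from
  \<open>u\<close> then exposes \<open>n l\<close>.\<close>

lemma reach_partner:
  assumes u: "u \<in> reach T" and ul: "adj u l" and l: "l \<notin> reach T"
    and n: "maximum n" "T \<subseteq> exposed n"
  shows "n l \<in> reach T"
proof -
  obtain p where p: "maximum p" "insert u T \<subseteq> exposed p" and uT: "u \<notin> T"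
    using u by (auto simp: reach_def)
  have u': "u \<in> V" "p u = u" using p by (auto simp: exposed_def)
  note mp = maximum_matching[OF p(1)] and mn = maximum_matching[OF n(1)]
  note wr = walk_in_reach[OF p uT mn]
  show ?thesis
  proof (cases "l \<in> component p n u")
    case True
    then show ?thesis
      by (rule component_cases[OF mp mn u']) (use wr l in \<open>auto simp: matching_involution[OF mn]\<close>)
  next
    case False
    let ?m = "\<lambda>w. if w \<in> component p n u then p w else n w"
    have "u \<in> exposed p" using p by simp
    note sw = maximum_switch_component[OF p(1) n(1) this]
    \<comment> \<open>The switch gives up only the final vertex, so \<open>T\<close> stays exposed
      once that vertex is known to lie outside it.\<close>
    have "final p n u \<notin> T"
      using wr[of "len p n u"] by (auto simp: final_def reach_def)
    then have T: "insert u T \<subseteq> exposed ?m" using n(2) sw(2) by auto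
    then have mu: "?m u = u" by (simp add: exposed_def)
    note rot = maximum_rotate[OF sw(1) mu ul]
    have ml: "?m l = n l" using False by simp
    have lV: "l \<in> V" using ul adj_V adj_sym by blast
    have nl: "n l \<noteq> l" using rot(1) ml by simp
    have "n l \<notin> T" using nl n(2) matching_involution[OF mn] by (auto simp: exposed_def)
    moreover have "l \<notin> T" using nl n(2) by (auto simp: exposed_def)
    moreover have "n l \<in> V" using matching_V[OF mn lV] .
    ultimately show ?thesis using rot(2) T uT unfolding ml reach_def
      by (auto simp: exposed_def intro!: exI)
  qed
qed

lemma final_image:
  assumes p: "maximum p" and q: "maximum q"
  shows "final p q ` exposed p = exposed q"
proof -
  note mp = maximum_matching[OF p] and mq = maximum_matching[OF q]
  have fx: "q (final p q x) = final p q x" if "x \<in> exposed p" for x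
    using that final_q_fixed[OF p mq] by (simp add: exposed_def)
  have "final p q ` exposed p \<subseteq> exposed q"
    using final_V[OF mp mq] fx by (auto simp: exposed_def)
  moreover have "inj_on (final p q) (exposed p)" using final_inj[OF mp mq fx] by simp
  ultimately show ?thesis
    using maximum_card[OF p q] by (intro card_subset_eq) (auto simp: card_image finite_exposed)
qed

text \<open>Each counted \<open>a\<close> is a point where a walk from a \<open>p\<close>-exposed
  vertex enters the closure of \<open>T\<close> or starts in it. Walks never leave the closure
  again, so each walk accounts for at most one \<open>a\<close>, and its end lies in
  \<open>T\<close>.\<close>

lemma card_boundary_le:
  fixes T :: "'a set"
  assumes p: "maximum p" and q: "maximum q" and T: "T \<subseteq> exposed q"
  defines "R \<equiv> reach T"
  shows "card {a \<in> V - R. p a \<notin> R \<and> (p a = a \<or> (\<exists>u \<in> R. adj u (p a)))} \<le> card T"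
    (is "card ?A \<le> _")
proof -
  note mp = maximum_matching[OF p] and mq = maximum_matching[OF q]
  let ?c = "walk p q" and ?n = "len p q" and ?X = "exposed p"
  have X: "x \<in> V" "p x = x" if "x \<in> ?X" for x using that by (auto simp: exposed_def)
  note fx = final_q_fixed[OF p mq X]
  define U where "U = (\<Union>x\<in>?X. component p q x)"
  note surj = final_image[OF p q]
  then have finals: "final p q ` ?X \<subseteq> exposed q" by simp
  have inj: "inj_on (final p q) ?X" using final_inj[OF mp mq fx] by simp
  have fin: "final p q x \<in> component p q x" for x by (simp add: component_def final_def trail_def)
  \<comment> \<open>\<open>m\<close> is \<open>q\<close> with the alternating cycles of \<open>p\<close> and \<open>q\<close> undone: applying \<open>reach_partner\<close> to \<open>m\<close>
    instead of \<open>q\<close> excludes entries into the closure of \<open>T\<close> that lie on a cycle.\<close>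
  define m where "m = (\<lambda>v. if v \<in> U then q v else p v)"
  have "p v \<in> U" "q v \<in> U" if "v \<in> U" for v
    using that component_p_closed[OF mp mq X] component_q_closed[OF mp mq X fx]
    unfolding U_def by blast+
  then have "matching m" unfolding m_def by (intro matching_switch mp mq)
  moreover have exm: "exposed m = exposed q"
  proof -
    have "exposed q \<subseteq> U" using fin unfolding surj[symmetric] U_def by blast
    moreover have "?X \<subseteq> U" using start_in_component[OF mp mq X] by (auto simp: U_def)
    ultimately show ?thesis by (auto simp: m_def exposed_def)
  qed
  ultimately have m: "maximum m" using maximum_if_card_le[OF q] by simp
  have walk_loopfree: "\<exists>n. maximum n \<and> n (?c x i) = ?c x i" if "x \<in> ?X" "i \<le> ?n x" for x i
    using walk_exposable[OF p mq X[OF that(1)] that(2)] by blast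
  \<comment> \<open>Even vertices of a walk can be exposed by maximum matchings, so
    \<open>reach_neighbour\<close> applies to them.\<close>
  have no_exit: "?c x i \<in> R" if "x \<in> ?X" "i \<le> ?n x" "u \<in> R" "adj u (?c x i)" for x i u
    using walk_loopfree[OF that(1,2)] reach_neighbour[of u T "?c x i"] that(3,4) unfolding R_def
    by blast
  \<comment> \<open>If the next even vertex were in \<open>R\<close>, so would be the current one:
    by \<open>no_exit\<close> when the odd vertex between them is in \<open>R\<close>, and by
    \<open>reach_partner\<close> for \<open>q\<close> when it is not.\<close>
  have step: "?c x (Suc i) \<notin> R" if x: "x \<in> ?X" and i: "i < ?n x" and c: "?c x i \<notin> R" for x i
  proof
    assume R: "?c x (Suc i) \<in> R"
    have ns: "\<not> stops p q x i" using not_stops[OF mp mq X[OF x]] i by blast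
    then have "adj (q (?c x i)) (?c x (Suc i))"
      using matching_adj[OF mp, of "q (?c x i)"] by (simp add: stops_def walk_Suc[OF mp mq X[OF x]])
    then have adj1: "adj (?c x (Suc i)) (q (?c x i))" by (rule adj_sym)
    have adj2: "adj (q (?c x i)) (?c x i)"
      using matching_adj[OF mq, of "?c x i"] ns adj_sym by (simp add: stops_def)
    show False
    proof (cases "q (?c x i) \<in> R")
      case True
      then show False using no_exit[OF x _ True adj2] i c by simp
    next
      case False
      then show False
        using reach_partner[of "?c x (Suc i)" T "q (?c x i)" q] R adj1 q T c
        by (simp add: R_def matching_involution[OF mq])
    qed
  qed
  have stay: "?c x j \<notin> R" if "x \<in> ?X" "j \<le> ?n x" "i \<le> j" "?c x i \<notin> R" for x i j
    using that(3,2) by (induction j rule: dec_induct) (use that step in auto)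
  define A where "A = ?A"
  have A_notin: "a \<notin> R" if "a \<in> A" for a using that by (simp add: A_def)
  \<comment> \<open>Index \<open>0\<close> covers an \<open>a\<close> exposed by \<open>p\<close>;
    any other \<open>a\<close> follows an odd vertex of its walk whose even predecessor is still in
    \<open>R\<close>.\<close>
  have ex: "\<exists>x i. x \<in> ?X \<and> i \<le> ?n x \<and> a = ?c x i \<and> (i = 0 \<or> ?c x (i - 1) \<in> R)" if a: "a \<in> ?A" for a
  proof (cases "p a = a")
    case True
    then show ?thesis using a walk_0[of p q] mp mq by (intro exI[of _ a] exI[of _ 0]) (auto simp: exposed_def walk_def)
  next
    case False
    then obtain u where u: "u \<in> R" "adj u (p a)" using a by auto
    let ?l = "p a"
    have ml: "m ?l \<in> R" using reach_partner[of u T ?l m] u a m T exm by (simp add: R_def)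
    have "?l \<in> U"
    proof (rule ccontr)
      assume "?l \<notin> U"
      then have "m ?l = a" by (simp add: m_def matching_involution[OF mp])
      then show False using ml a by simp
    qed
    then obtain x where x: "x \<in> ?X" "?l \<in> component p q x" and ql: "q ?l \<in> R"
      using ml by (auto simp: U_def m_def)
    from x(2) show ?thesis
    proof (rule component_cases[OF mp mq X[OF x(1)]])
      fix i assume "i \<le> ?n x" "?l = ?c x i"
      then have False using no_exit[of x i u] x u a by auto
      then show ?thesis ..
    next
      fix i assume i: "i < ?n x" "?l = q (?c x i)"
      then have "a = ?c x (Suc i)"
        by (metis walk_Suc[OF mp mq X[OF x(1)]] matching_involution[OF mp])
      then show ?thesis using i x ql
        by (intro exI[of _ x] exI[of _ "Suc i"]) (simp add: matching_involution[OF mq])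
    qed
  qed
  have "\<forall>a\<in>A. \<exists>z. fst z \<in> ?X \<and> snd z \<le> ?n (fst z) \<and> a = ?c (fst z) (snd z) \<and>
      (snd z = 0 \<or> ?c (fst z) (snd z - 1) \<in> R)"
    using ex unfolding A_def by auto
  from bchoice[OF this] obtain z where z: "\<forall>a\<in>A. fst (z a) \<in> ?X \<and> snd (z a) \<le> ?n (fst (z a)) \<and>
      a = ?c (fst (z a)) (snd (z a)) \<and> (snd (z a) = 0 \<or> ?c (fst (z a)) (snd (z a) - 1) \<in> R)" ..
  define f g where "f = fst \<circ> z" and "g = snd \<circ> z"
  have f: "f a \<in> ?X" and g: "g a \<le> ?n (f a)" and fg: "?c (f a) (g a) = a"
    and g0: "g a = 0 \<or> ?c (f a) (g a - 1) \<in> R" if "a \<in> A" for a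
    using z that by (auto simp: f_def g_def)
  have inj_f: "inj_on f A"
  proof (rule inj_onI)
    fix a b assume ab: "a \<in> A" "b \<in> A" "f a = f b"
    \<comment> \<open>The later entry would need its predecessor in \<open>R\<close>, but the walk
      stays outside \<open>R\<close> from index \<open>g a\<close> on.\<close>
    have less: "\<not> g a < g b" if "a \<in> A" "b \<in> A" "f a = f b" for a b
    proof
      assume "g a < g b"
      then have "?c (f b) (g b - 1) \<notin> R"
        using that g[OF that(2)] fg[OF that(1)] A_notin[OF that(1)]
        by (intro stay[of "f b" "g b - 1" "g a"] f) auto
      then show False using g0[OF that(2)] \<open>g a < g b\<close> by simp
    qed
    then have "g a = g b" using ab by (metis linorder_neqE_nat)
    then have "?c (f a) (g a) = ?c (f b) (g b)" using ab(3) by (rule arg_cong2[rotated])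
    then show "a = b" unfolding fg[OF ab(1)] fg[OF ab(2)] .
  qed
  have "final p q (f a) \<in> T" if a: "a \<in> A" for a
  proof -
    have "final p q (f a) \<notin> R"
      unfolding final_def by (rule stay[OF f[OF a] order_refl g[OF a]]) (simp only: fg[OF a] A_notin[OF a] not_False_eq_True)
    moreover have "final p q (f a) \<in> exposed q" using finals f[OF a] by blast
    \<comment> \<open>If this exposed vertex were outside \<open>T\<close>, the matching
      \<open>q\<close> itself would witness that it belongs to \<open>reach T\<close>.\<close>
    ultimately show ?thesis using q T by (auto simp: R_def reach_def exposed_def)
  qed
  moreover have "inj_on (final p q \<circ> f) A"
    using inj_f f by (intro comp_inj_on inj_on_subset[OF inj]) auto
  moreover have "finite T" using T finite_exposed finite_subset by blast
  ultimately have "card A \<le> card T" by (intro card_inj_on_le[of "final p q \<circ> f"]) auto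
  then show ?thesis by (simp add: A_def)
qed

end

subsection \<open>The matching graph of a bidirected graph\<close>

locale bidigraph_source =
  fixes B :: "('v, 'e) bidigraph" and X :: "'v set"
  assumes B: "finite_bidirected_graph B" and X: "X \<subseteq> verts B"
begin

text \<open>
  The first half-edge of a path may have either sign, so the signs at vertices of \<open>X\<close> carry no
  information and are all sent to \<open>Plus\<close>.
\<close>

definition node :: "'v \<Rightarrow> sign \<Rightarrow> 'v \<times> sign" where
  "node v s = (v, if v \<in> X then Plus else s)"

definition nodes :: "('v \<times> sign) set" where
  "nodes = {node v s | v s. v \<in> verts B}"

definition partner :: "'v \<times> sign \<Rightarrow> 'v \<times> sign" where
  "partner a = (if fst a \<in> verts B - X then (fst a, opposite (snd a)) else a)"

definition half_edge :: "'e \<Rightarrow> 'v \<Rightarrow> 'v \<times> sign" where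
  "half_edge e v = node v (half_sign B e v)"

text \<open>A path that enters a vertex outside \<open>X\<close> by one half-edge node must leave it
  by the opposite one. Crossing the partner edge between the two edges of \<open>B\<close> encodes
  this sign condition.\<close>

definition node_adj :: "'v \<times> sign \<Rightarrow> 'v \<times> sign \<Rightarrow> bool" where
  "node_adj a b \<longleftrightarrow> a \<in> nodes \<and> b \<in> nodes \<and> a \<noteq> b \<and>
     (b = partner a \<or> (\<exists>e \<in> edges B. \<exists>u v. ends B e = {u, v} \<and> a = half_edge e u \<and> b = half_edge e v))"

lemma opposite_opposite [simp]: "opposite (opposite s) = s"
  by (cases s) auto

lemma opposite_neq [simp]: "opposite s \<noteq> s"
  by (cases s) auto

lemma eq_opposite: "s \<noteq> t \<Longrightarrow> s = opposite t"
  by (cases s; cases t) auto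

lemma fst_node [simp]: "fst (node v s) = v"
  by (simp add: node_def)

lemma fst_half_edge [simp]: "fst (half_edge e v) = v"
  by (simp add: half_edge_def)

lemma fst_partner [simp]: "fst (partner a) = fst a"
  by (simp add: partner_def)

lemma partner_partner [simp]: "partner (partner a) = a"
  by (auto simp: partner_def)

lemma node_in_nodes [simp]: "node v s \<in> nodes \<longleftrightarrow> v \<in> verts B"
  by (auto simp: nodes_def node_def)

lemma nodes_eq: "a \<in> nodes \<Longrightarrow> a = node (fst a) (snd a)"
  by (auto simp: nodes_def node_def)

lemma fst_in_verts: "a \<in> nodes \<Longrightarrow> fst a \<in> verts B"
  by (auto simp: nodes_def)

lemma partner_in_nodes: "a \<in> nodes \<Longrightarrow> partner a \<in> nodes"
  by (auto simp: nodes_def node_def partner_def)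

lemma partner_eq_iff: "a \<in> nodes \<Longrightarrow> partner a = a \<longleftrightarrow> fst a \<in> X"
  by (cases a) (auto simp: partner_def fst_in_verts dest: fst_in_verts)

lemma nodes_in_X: "a \<in> nodes \<Longrightarrow> fst a \<in> X \<Longrightarrow> a = (fst a, Plus)"
  by (auto simp: nodes_def node_def)

lemma nodes_same_vertex:
  assumes "a \<in> nodes" "b \<in> nodes" "fst a = fst b"
  shows "b = a \<or> b = partner a"
proof (cases "fst a \<in> X")
  case True
  then show ?thesis using assms nodes_in_X by metis
next
  case False
  then show ?thesis using assms fst_in_verts[OF assms(1)] eq_opposite[of "snd b" "snd a"]
    by (cases a; cases b) (auto simp: partner_def)
qed

lemma start_node: "x \<in> X \<Longrightarrow> (x, Plus) \<in> nodes" "x \<in> X \<Longrightarrow> partner (x, Plus) = (x, Plus)"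
  using X by (auto simp: nodes_def node_def partner_def)

sublocale matching_graph nodes node_adj
proof
  have "nodes \<subseteq> verts B \<times> {Plus, Minus}"
    by (auto simp: nodes_def node_def) (metis sign.exhaust)
  moreover have "finite (verts B)" using B by (simp add: finite_bidirected_graph_def)
  ultimately show "finite nodes" by (meson finite.emptyI finite.insertI finite_SigmaI finite_subset)
  show "node_adj b a" if "node_adj a b" for a b
  proof -
    have "a = partner b" if "b = partner a" using that by simp
    moreover have "ends B e = {v, u}" if "ends B e = {u, v}" for e u v using that by auto
    ultimately show ?thesis using that unfolding node_adj_def by blast
  qed
qed (auto simp: node_adj_def)

lemma node_adj_edge:
  assumes "e \<in> edges B" "ends B e = {u, v}"
  shows "node_adj (half_edge e u) (half_edge e v)"
proof -
  have "ends B e \<subseteq> verts B" "card (ends B e) = 2"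
    using B assms(1) by (auto simp: finite_bidirected_graph_def bidirected_graph_def)
  then have "u \<noteq> v" "u \<in> verts B" "v \<in> verts B" using assms(2) by auto
  then show ?thesis using assms unfolding node_adj_def half_edge_def
    by (metis fst_node node_in_nodes)
qed

lemma matching_partner: "matching partner"
proof -
  have "node_adj a (partner a)" if "partner a \<noteq> a" for a
  proof -
    have "a \<in> nodes"
      using that by (cases a) (auto simp: partner_def nodes_def node_def split: if_splits)
    then show ?thesis using that partner_in_nodes by (simp add: node_adj_def)
  qed
  then show ?thesis by (simp add: matching_def)
qed

lemma exposed_partner: "exposed partner = (\<lambda>x. (x, Plus)) ` X"
proof -
  have "a \<in> (\<lambda>x. (x, Plus)) ` X" if "a \<in> nodes" "partner a = a" for a
    using that partner_eq_iff[of a] nodes_in_X[of a] by auto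
  then show ?thesis using start_node by (auto simp: exposed_def)
qed

section \<open>Alternating walks read as paths of \<open>B\<close>\<close>

context
  fixes m :: "'v \<times> sign \<Rightarrow> 'v \<times> sign" and x :: 'v
  assumes m: "matching m" and x: "x \<in> X"
begin

abbreviation (input) "w \<equiv> walk partner m (x, Plus)"

lemmas walk_facts = matching_partner m start_node[OF x]

lemma fst_walk_Suc: "fst (w (Suc j)) = fst (m (w j))"
  by (simp add: walk_Suc[OF walk_facts])

text \<open>A repeated vertex would make the newest \<open>m\<close>-partner equal to an earlier
  node or its partner, both on the trail. The bound \<open>Suc j < k\<close> lets the last node lie
  over \<open>X\<close>, as happens for augmenting walks.\<close>

lemma walk_fst_inj:
  assumes "\<forall>j<k. m (w j) \<noteq> w j" "\<forall>j. Suc j < k \<longrightarrow> partner (m (w j)) \<noteq> m (w j)" "j < k"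
  shows "fst (w j) \<noteq> fst (w k)"
proof
  assume eq: "fst (w j) = fst (w k)"
  obtain i where k: "k = Suc i" using assms(3) by (cases k) auto
  have "\<forall>j<i. \<not> stops partner m (x, Plus) j" using assms by (auto simp: k stops_def)
  then have fresh: "m (w i) \<notin> trail partner m (x, Plus) i"
    using q_walk_fresh[OF walk_facts] assms(1) k by blast
  have "w j \<in> trail partner m (x, Plus) i"
    using walk_in_trail[OF walk_facts, of j i] assms(3) k by simp
  moreover then have "partner (w j) \<in> trail partner m (x, Plus) i"
    by (rule trail_closed[OF walk_facts])
  moreover have "m (w i) = w j \<or> m (w i) = partner (w j)"
    using eq walk_V[OF walk_facts] matching_V[OF m]
    by (intro nodes_same_vertex) (simp_all add: k fst_walk_Suc)
  ultimately show False using fresh by auto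
qed

text \<open>Freshness excludes that \<open>m\<close> matches \<open>w j\<close> to its partner, so
  every \<open>m\<close>-edge used comes from an edge of \<open>B\<close>; the partner step between
  two of them flips the sign.\<close>

lemma walk_is_path:
  assumes ne: "\<forall>j<i. m (w j) \<noteq> w j" and pne: "\<forall>j. Suc j < i \<longrightarrow> partner (m (w j)) \<noteq> m (w j)"
  shows "\<exists>es. is_path B (map (\<lambda>j. fst (w j)) [0..<Suc i], es)"
proof -
  have inj: "fst (w j) \<noteq> fst (w k)" if "j < k" "k \<le> i" for j k
    using that ne pne by (intro walk_fst_inj) auto
  have "\<exists>e. e \<in> edges B \<and> ends B e = {fst (w j), fst (w (Suc j))} \<and>
      w j = half_edge e (fst (w j)) \<and> m (w j) = half_edge e (fst (w (Suc j)))" if j: "j < i" for j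
  proof -
    have "\<forall>k<j. \<not> stops partner m (x, Plus) k" using ne pne j by (auto simp: stops_def)
    then have "m (w j) \<notin> trail partner m (x, Plus) j"
      using q_walk_fresh[OF walk_facts] ne j by blast
    moreover have "partner (w j) \<in> trail partner m (x, Plus) j"
      by (intro trail_closed[OF walk_facts] walk_in_trail[OF walk_facts] order_refl)
    ultimately have "m (w j) \<noteq> partner (w j)" by auto
    moreover have "node_adj (w j) (m (w j))" using ne j matching_adj[OF m] by metis
    ultimately obtain e u v where "e \<in> edges B" "ends B e = {u, v}"
      and "w j = half_edge e u" "m (w j) = half_edge e v"
      unfolding node_adj_def by blast
    then show ?thesis by (intro exI[of _ e]) (simp add: fst_walk_Suc)
  qed
  then obtain f where f: "f j \<in> edges B" "ends B (f j) = {fst (w j), fst (w (Suc j))}"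
    "w j = half_edge (f j) (fst (w j))" "m (w j) = half_edge (f j) (fst (w (Suc j)))" if "j < i" for j
    by metis
  have "inj_on (\<lambda>j. fst (w j)) {..i}"
    by (rule linorder_inj_onI) (use inj in auto)
  moreover have "f j \<noteq> f k" if "j < k" "k < i" for j k
  proof
    assume "f j = f k"
    then have "fst (w j) \<in> {fst (w k), fst (w (Suc k))}" using f(2)[of j] f(2)[of k] that by auto
    then show False using inj[of j k] inj[of j "Suc k"] that by auto
  qed
  then have "inj_on f {..<i}"
    by (intro linorder_inj_onI) auto
  moreover have "half_sign B (f (Suc j)) (fst (w (Suc j))) = opposite (half_sign B (f j) (fst (w (Suc j))))"
    if j: "Suc j < i" for j
  proof -
    let ?v = "fst (w (Suc j))"
    have e: "half_edge (f (Suc j)) ?v = w (Suc j)" "half_edge (f j) ?v = m (w j)"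
      using f(3)[OF j, symmetric] f(4)[OF Suc_lessD[OF j], symmetric] .
    have ws: "w (Suc j) = partner (m (w j))" by (rule walk_Suc[OF walk_facts])
    then have "half_edge (f (Suc j)) ?v = partner (half_edge (f j) ?v)" unfolding e .
    \<comment> \<open>A partner step that changes the node takes place outside \<open>X\<close>,
      where nodes retain the sign of the half-edge.\<close>
    moreover have "w (Suc j) \<noteq> m (w j)" using pne j ws by metis
    then have "half_edge (f (Suc j)) ?v \<noteq> half_edge (f j) ?v" unfolding e .
    ultimately show ?thesis
      by (auto simp: half_edge_def node_def partner_def split: if_splits)
  qed
  moreover have "fst (w j) \<in> verts B" for j using walk_V[OF walk_facts] fst_in_verts by blast
  ultimately have "is_path B (map (\<lambda>j. fst (w j)) [0..<Suc i], map f [0..<i])"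
    using f(1,2) unfolding is_path_def
    by (auto simp: distinct_map atLeast0LessThan lessThan_Suc_atMost nth_append simp del: upt_Suc)
  then show ?thesis ..
qed

end

definition clean :: bool where
  "clean \<longleftrightarrow> \<not> (\<exists>P. is_path B P \<and> \<not> trivial_path P \<and> first_vert P \<in> X \<and> last_vert P \<in> X)"

text \<open>By \<open>card_exposed_le\<close> it suffices that no walk augments. An augmenting walk
  would be a nontrivial path with both ends in \<open>X\<close>.\<close>

lemma maximum_partner:
  assumes clean
  shows "maximum partner"
proof -
  have "m (final partner m a) = final partner m a" if m: "matching m" and a: "a \<in> exposed partner" for m a
  proof (rule ccontr)
    assume ne: "m (final partner m a) \<noteq> final partner m a"
    obtain x where x: "x \<in> X" and a: "a = (x, Plus)" using a by (auto simp: exposed_partner)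
    note wf = matching_partner m start_node[OF x]
    let ?c = "walk partner m a" and ?n = "len partner m a"
    have ns: "\<forall>j<?n. \<not> stops partner m a j" using not_stops[OF wf] by (simp add: a)
    have "partner (m (?c ?n)) = m (?c ?n)"
      using ne stops_len[OF wf] by (simp add: a final_def stops_def)
    \<comment> \<open>\<open>partner\<close> fixes the odd end, so the walk at \<open>Suc ?n\<close>
      is that end itself, and nodes fixed by \<open>partner\<close> lie over
      \<open>X\<close>.\<close>
    then have X: "fst (?c (Suc ?n)) \<in> X"
      using partner_eq_iff[of "m (?c ?n)"] matching_V[OF m walk_V[OF wf]] by (simp add: a fst_walk_Suc[OF m x])
    have "\<exists>es. is_path B (map (\<lambda>j. fst (?c j)) [0..<Suc (Suc ?n)], es)"
      using ns ne unfolding a by (intro walk_is_path[OF m x]) (auto simp: stops_def final_def less_Suc_eq)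
    then obtain es where es: "is_path B (map (\<lambda>j. fst (?c j)) [0..<Suc (Suc ?n)], es)" ..
    let ?P = "(map (\<lambda>j. fst (?c j)) [0..<Suc (Suc ?n)], es)"
    have "length es = Suc ?n" using es by (simp add: is_path_def)
    then have "\<not> trivial_path ?P" by (simp add: trivial_path_def)
    moreover have "first_vert ?P \<in> X"
      using x by (simp add: first_vert_def hd_map a walk_def del: upt_Suc)
    moreover have "last_vert ?P \<in> X" using X by (simp add: last_vert_def)
    ultimately have "\<exists>P. is_path B P \<and> \<not> trivial_path P \<and> first_vert P \<in> X \<and> last_vert P \<in> X"
      using es by blast
    then show False using assms by (simp add: clean_def)
  qed
  then show ?thesis
    unfolding maximum_def using matching_partner card_exposed_le[OF matching_partner] by blast
qed

section \<open>From exposed nodes over \<open>Y\<close> to disjoint paths\<close>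

context
  assumes clean: clean
begin

lemma start_exposed: "x \<in> X \<Longrightarrow> (x, Plus) \<in> exposed partner"
  by (simp add: exposed_partner)

lemma component_in_nodes:
  assumes "matching q" "x \<in> X" "a \<in> component partner q (x, Plus)"
  shows "a \<in> nodes"
  by (rule component_cases[OF matching_partner assms(1) start_node[OF assms(2)] assms(3)])
    (use walk_V[OF matching_partner assms(1) start_node[OF assms(2)]] matching_V[OF assms(1)] in auto)

text \<open>Components are closed under \<open>partner\<close>, so a component contains every node
  of each vertex it meets.\<close>

lemma component_vertex_disjoint:
  assumes q: "maximum q" and x: "x \<in> X" and y: "y \<in> X"
    and a: "a \<in> component partner q (x, Plus)" and b: "b \<in> component partner q (y, Plus)"
    and ab: "fst a = fst b"
  shows "x = y"
proof -
  note mq = maximum_matching[OF q] and mp = matching_partner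
  have "a = b \<or> a = partner b"
    using nodes_same_vertex[of b a] component_in_nodes[OF mq x a] component_in_nodes[OF mq y b] ab
    by auto
  then have "a \<in> component partner q (y, Plus)"
    using b component_p_closed[OF mp mq start_node[OF y] b] by auto
  then have "(x, Plus) = (y, Plus)"
    using final_q_fixed[OF maximum_partner[OF clean] mq start_node[OF x]]
      final_q_fixed[OF maximum_partner[OF clean] mq start_node[OF y]] a
    by (intro component_disjoint[OF mp mq start_exposed[OF x] start_exposed[OF y]])
  then show ?thesis by simp
qed

text \<open>The walk is cut at its first vertex in \<open>Y\<close>. It meets \<open>X\<close> only
  at its start, because nodes over \<open>X\<close> are exposed by \<open>partner\<close>.\<close>

lemma set_path_in_component:
  assumes q: "maximum q" and x: "x \<in> X" and Y: "fst (final partner q (x, Plus)) \<in> Y"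
  shows "\<exists>P. set_path B X Y P \<and> path_verts P \<subseteq> fst ` component partner q (x, Plus)"
proof -
  note mq = maximum_matching[OF q]
  note wf = matching_partner mq start_node[OF x]
  let ?w = "walk partner q (x, Plus)" and ?n = "len partner q (x, Plus)"
  let ?v = "\<lambda>j. fst (?w j)"
  define i where "i = (LEAST i. ?v i \<in> Y)"
  have nY: "?v ?n \<in> Y" using Y by (simp only: final_def)
  have iY: "?v i \<in> Y" unfolding i_def using nY by (rule LeastI[of "\<lambda>i. ?v i \<in> Y"])
  have "i \<le> ?n" unfolding i_def using nY by (rule Least_le[of "\<lambda>i. ?v i \<in> Y"])
  have least: "?v j \<notin> Y" if "j < i" for j using that not_less_Least unfolding i_def by blast
  have ns: "\<not> stops partner q (x, Plus) j" if "j < i" for j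
    using not_stops[OF wf] that \<open>i \<le> ?n\<close> by simp
  have "\<exists>es. is_path B (map ?v [0..<Suc i], es)"
    using ns by (intro walk_is_path[OF mq x]) (auto simp: stops_def)
  then obtain es where path: "is_path B (map ?v [0..<Suc i], es)" ..
  let ?P = "(map ?v [0..<Suc i], es)"
  have pv: "path_verts ?P = ?v ` {..i}"
    by (simp add: path_verts_def atLeast0LessThan lessThan_Suc_atMost del: upt_Suc)
  have comp: "?w j \<in> component partner q (x, Plus)" if "j \<le> i" for j
    using that \<open>i \<le> ?n\<close> unfolding component_def by (intro walk_in_trail[OF wf]) simp
  have "?v j = x" if "j \<le> i" "?v j \<in> X" for j
  proof -
    have "partner (?w j) = ?w j" using that(2) partner_eq_iff walk_V[OF wf] by blast
    then have "?w j = (x, Plus)" using component_p_fixed[OF wf comp[OF that(1)]] by blast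
    then show ?thesis by simp
  qed
  moreover have v0: "?v 0 = x" by (simp add: walk_0[OF wf])
  ultimately have "path_verts ?P \<inter> X = {x}" unfolding pv using x by force
  moreover have "first_vert ?P = x" using v0 by (simp add: first_vert_def hd_map del: upt_Suc)
  moreover have "path_verts ?P \<inter> Y = {?v i}"
    unfolding pv using iY least by (auto simp: le_less)
  moreover have "last_vert ?P = ?v i" by (simp add: last_vert_def)
  ultimately have "set_path B X Y ?P" using path by (simp add: set_path_def)
  moreover have "path_verts ?P \<subseteq> fst ` component partner q (x, Plus)" unfolding pv using comp by auto
  ultimately show ?thesis by blast
qed

text \<open>By \<open>final_image\<close>, every node exposed by \<open>q\<close> ends a walk that
  starts over \<open>X\<close>; the walks ending over \<open>Y\<close> give paths in distinct
  components.\<close>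

lemma disjoint_paths_of_maximum:
  assumes q: "maximum q"
  shows "\<exists>\<P>. disjoint_set_paths B X Y \<P> \<and> finite \<P> \<and> card {a \<in> exposed q. fst a \<in> Y} \<le> card \<P>"
proof -
  define X' where "X' = {x \<in> X. fst (final partner q (x, Plus)) \<in> Y}"
  have "\<forall>x\<in>X'. \<exists>P. set_path B X Y P \<and> path_verts P \<subseteq> fst ` component partner q (x, Plus)"
    using set_path_in_component[OF q] by (simp add: X'_def)
  from bchoice[OF this] obtain P where
    P: "\<And>x. x \<in> X' \<Longrightarrow> set_path B X Y (P x)"
       "\<And>x. x \<in> X' \<Longrightarrow> path_verts (P x) \<subseteq> fst ` component partner q (x, Plus)" by auto
  have disj: "x = y" if xy: "x \<in> X'" "y \<in> X'" and ne: "path_verts (P x) \<inter> path_verts (P y) \<noteq> {}" for x y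
  proof -
    obtain v where v: "v \<in> path_verts (P x)" "v \<in> path_verts (P y)" using ne by blast
    obtain a where a: "a \<in> component partner q (x, Plus)" "v = fst a"
      using P(2)[OF xy(1)] v(1) by blast
    obtain b where b: "b \<in> component partner q (y, Plus)" "v = fst b"
      using P(2)[OF xy(2)] v(2) by blast
    have "x \<in> X" "y \<in> X" using xy by (simp_all add: X'_def)
    then show ?thesis using component_vertex_disjoint[OF q _ _ a(1) b(1)] a(2) b(2) by simp
  qed
  have ne: "path_verts (P x) \<noteq> {}" if "x \<in> X'" for x using P(1)[OF that] by (auto simp: set_path_def)
  have "inj_on P X'"
  proof (rule inj_onI)
    fix x y assume "x \<in> X'" "y \<in> X'" "P x = P y"
    then show "x = y" using disj[of x y] ne[of x] by simp
  qed
  moreover have fX: "finite X'"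
    using X B unfolding X'_def finite_bidirected_graph_def by (metis (no_types) finite_Collect_conjI finite_subset Collect_mem_eq)
  moreover have "{a \<in> exposed q. fst a \<in> Y} \<subseteq> (\<lambda>x. final partner q (x, Plus)) ` X'"
    unfolding final_image[OF maximum_partner[OF clean] q, symmetric] exposed_partner X'_def by blast
  then have "card {a \<in> exposed q. fst a \<in> Y} \<le> card X'"
    using fX by (meson card_image_le card_mono finite_imageI le_trans)
  moreover have "disjoint_set_paths B X Y (P ` X')"
    unfolding disjoint_set_paths_def using P(1) disj by blast
  ultimately show ?thesis by (intro exI[of _ "P ` X'"]) (simp add: card_image)
qed

text \<open>A path from \<open>X\<close> is alternating for the partner matching; rotating along it exposes the
  half-edge through which it is about to leave a vertex.\<close>

lemma path_exposable:
  assumes path: "is_path B (vs, es)" and X0: "vs ! 0 \<in> X"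
    and notX: "\<And>j. 0 < j \<Longrightarrow> j < length es \<Longrightarrow> vs ! j \<notin> X" and i: "i < length es"
  shows "\<exists>m. maximum m \<and> m (half_edge (es ! i) (vs ! i)) = half_edge (es ! i) (vs ! i) \<and>
    (\<forall>a. fst a \<notin> (!) vs ` {..i} \<longrightarrow> m a = partner a)"
  using i
proof (induction i)
  case 0
  have "half_edge (es ! 0) (vs ! 0) = (vs ! 0, Plus)" using X0 by (simp add: half_edge_def node_def)
  then show ?case using maximum_partner[OF clean] start_node(2)[OF X0] by auto
next
  case (Suc i)
  let ?u = "vs ! i" and ?v = "vs ! Suc i" and ?e = "es ! i" and ?f = "es ! Suc i"
  obtain m where m: "maximum m" "m (half_edge ?e ?u) = half_edge ?e ?u"
    "\<forall>a. fst a \<notin> (!) vs ` {..i} \<longrightarrow> m a = partner a"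
    using Suc by auto
  have e: "?e \<in> edges B" "ends B ?e = {?u, ?v}"
    and sgn: "half_sign B ?f ?v = opposite (half_sign B ?e ?v)"
    and d: "distinct vs" "length vs = Suc (length es)" and vsB: "set vs \<subseteq> verts B"
    using path Suc.prems by (auto simp: is_path_def)
  have "?v \<in> verts B" using vsB d Suc.prems by (intro subsetD[OF vsB] nth_mem) simp
  then have partner: "partner (half_edge ?e ?v) = half_edge ?f ?v"
    using notX[of "Suc i"] Suc.prems sgn by (simp add: half_edge_def node_def partner_def)
  have "?v \<notin> (!) vs ` {..i}" using d Suc.prems by (auto simp: nth_eq_iff_index_eq)
  then have mv: "m (half_edge ?e ?v) = half_edge ?f ?v" using m(3)[rule_format, of "half_edge ?e ?v"] partner by simp
  note rot = maximum_rotate(2)[OF m(1,2) node_adj_edge[OF e], unfolded mv]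
  have "(!) vs ` {..Suc i} = insert ?v ((!) vs ` {..i})" by (simp add: atMost_Suc)
  then have "(m(half_edge ?e ?u := half_edge ?e ?v, half_edge ?e ?v := half_edge ?e ?u,
      half_edge ?f ?v := half_edge ?f ?v)) a = partner a" if "fst a \<notin> (!) vs ` {..Suc i}" for a
    using m(3)[rule_format, of a] that by auto
  then show ?case using rot by (metis fun_upd_same)
qed

text \<open>\<open>u\<close> is the second to last vertex of the witnessing path, which is
  nontrivial since \<open>v\<close> is outside \<open>X\<close>. Rotating along that path exposes
  the node at \<open>u\<close> of its last edge.\<close>

lemma epsilon_arc:
  assumes "v \<in> epsilon X B W" "v \<notin> X"
  obtains e u m where "e \<in> edges B" "ends B e = {u, v}" "u \<in> verts B" "u \<notin> W"
    "maximum m" "m (half_edge e u) = half_edge e u"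
proof -
  obtain P where P: "set_path B X {v} P" "trivial_path P \<or> second_to_last_vert P \<notin> W"
    using assms by (auto simp: epsilon_def)
  obtain vs es where Pe: "P = (vs, es)" by (cases P)
  have path: "is_path B (vs, es)" and X1: "set vs \<inter> X = {hd vs}" and v: "set vs \<inter> {v} = {last vs}"
    using P(1) by (auto simp: Pe set_path_def path_verts_def first_vert_def last_vert_def)
  have len: "length vs = Suc (length es)" and dist: "distinct vs" using path by (auto simp: is_path_def)
  then have vs0: "hd vs = vs ! 0" and vl: "last vs = vs ! length es"
    by (auto simp: hd_conv_nth last_conv_nth simp flip: length_0_conv)
  have lv: "last vs = v" using v by auto
  have hX: "hd vs \<in> X" using X1 by blast
  have "es \<noteq> []"
  proof
    assume "es = []"
    then show False using hX assms(2) lv vl vs0 by simp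
  qed
  then obtain i where i: "length es = Suc i" by (cases es) auto
  have "\<exists>m. maximum m \<and> m (half_edge (es ! i) (vs ! i)) = half_edge (es ! i) (vs ! i) \<and>
    (\<forall>a. fst a \<notin> (!) vs ` {..i} \<longrightarrow> m a = partner a)"
  proof (rule path_exposable[OF path])
    show "vs ! 0 \<in> X" using hX vs0 by simp
    show "vs ! j \<notin> X" if "0 < j" "j < length es" for j
    proof
      assume "vs ! j \<in> X"
      then have "vs ! j = vs ! 0" using X1 vs0 that len by (metis IntI less_SucI nth_mem singletonD)
      then show False using that len dist by (simp add: nth_eq_iff_index_eq)
    qed
  qed (simp add: i)
  then obtain m where m: "maximum m" "m (half_edge (es ! i) (vs ! i)) = half_edge (es ! i) (vs ! i)"
    by blast
  have "second_to_last_vert P = vs ! i"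
  proof -
    have "length (butlast vs) = Suc i" using len i by simp
    then show ?thesis using len i
      by (simp add: Pe second_to_last_vert_def last_conv_nth nth_butlast flip: length_0_conv)
  qed
  then have "vs ! i \<notin> W" using P(2) i by (auto simp: Pe trivial_path_def)
  moreover have "es ! i \<in> edges B" "ends B (es ! i) = {vs ! i, v}" "vs ! i \<in> verts B"
    using path i lv vl len by (auto simp: is_path_def)
  ultimately show ?thesis using m that by blast
qed

text \<open>The hard inequality: \<open>card_boundary_le\<close> bounds \<open>epsilon\<close> by
  the number of exposed nodes over \<open>Y\<close>, and \<open>disjoint_paths_of_maximum\<close>
  supplies as many paths.\<close>

lemma epsilon_bound:
  assumes Y: "Y \<subseteq> verts B"
  shows "\<exists>W \<P>. Y \<subseteq> W \<and> W \<subseteq> verts B \<and> disjoint_set_paths B X Y \<P> \<and> finite \<P> \<and>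
    card (epsilon X B W) \<le> card \<P>"
proof -
  let ?S = "\<lambda>q. {a \<in> exposed q. fst a \<in> Y}"
  have "\<exists>q. maximum q \<and> (\<forall>m. maximum m \<longrightarrow> card (?S m) \<le> card (?S q))"
  proof (rule ex_has_greatest_nat[where P = maximum and f = "\<lambda>m. card (?S m)"])
    have "card (?S m) \<le> card nodes" for m
      by (intro card_mono finite_V) (auto simp: exposed_def)
    then show "\<forall>m. maximum m \<longrightarrow> card (?S m) < Suc (card nodes)" by (simp add: less_Suc_eq_le)
  qed (rule maximum_partner[OF clean])
  then obtain q where q: "maximum q" and qmax: "\<And>m. maximum m \<Longrightarrow> card (?S m) \<le> card (?S q)"
    by blast
  define R where "R = reach (?S q)"
  \<comment> \<open>A node of \<open>R\<close> over \<open>Y\<close> could be exposed together with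
    all of \<open>?S q\<close>, against the choice of \<open>q\<close>.\<close>
  have RY: "fst a \<notin> Y" if "a \<in> R" for a
  proof
    assume aY: "fst a \<in> Y"
    obtain n where n: "maximum n" "insert a (?S q) \<subseteq> exposed n" "a \<notin> ?S q"
      using \<open>a \<in> R\<close> by (auto simp: R_def reach_def)
    then have "insert a (?S q) \<subseteq> ?S n" using aY by auto
    then have "card (insert a (?S q)) \<le> card (?S n)"
      by (intro card_mono) (simp_all add: finite_exposed)
    then show False using qmax[OF n(1)] n(3) finite_exposed[of q] by simp
  qed
  define W where "W = {v \<in> verts B. \<forall>s. node v s \<notin> R}"
  have "Y \<subseteq> W" using Y RY[of "node _ _"] unfolding W_def fst_node by blast
  let ?A = "{a \<in> nodes - R. partner a \<notin> R \<and> (partner a = a \<or> (\<exists>u\<in>R. node_adj u (partner a)))}"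
  have "v \<in> fst ` ?A" if v: "v \<in> epsilon X B W" for v
  proof -
    have vW: "v \<in> verts B" "\<And>s. node v s \<notin> R" using v by (auto simp: epsilon_def W_def)
    show ?thesis
    proof (cases "v \<in> X")
      case True
      then have "(v, Plus) = node v Plus" by (simp add: node_def)
      then have "(v, Plus) \<in> ?A" using vW(2) start_node[OF True] by simp
      then show ?thesis by force
    next
      case False
      obtain e u m where e: "e \<in> edges B" "ends B e = {u, v}" and u: "u \<in> verts B" "u \<notin> W"
        and m: "maximum m" "m (half_edge e u) = half_edge e u"
        by (rule epsilon_arc[OF v False])
      obtain s where s: "node u s \<in> R" using u by (auto simp: W_def)
      \<comment> \<open>That \<open>u\<close> is outside \<open>W\<close> puts only some node of
        \<open>u\<close> in \<open>R\<close>. If it is the other one, \<open>reach_neighbour\<close>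
        carries membership across the partner edge, since \<open>m\<close> exposes
        \<open>half_edge e u\<close>.\<close>
      have uR: "half_edge e u \<in> R"
      proof (cases "node u s = half_edge e u")
        case False
        then have "half_edge e u = partner (node u s)"
          using nodes_same_vertex[of "node u s" "half_edge e u"] u(1) by (simp add: half_edge_def)
        then have "node_adj (node u s) (half_edge e u)"
          using matching_adj[OF matching_partner, of "node u s"] False by simp
        then show ?thesis using reach_neighbour[of "node u s" "?S q" "half_edge e u" m] s m
          by (simp add: R_def)
      qed (use s in simp)
      \<comment> \<open>The node \<open>half_edge e v\<close> plays the odd vertex at which a walk
        enters; \<open>card_boundary_le\<close> counts the even vertex after it.\<close>
      let ?a = "partner (half_edge e v)"
      have hv: "half_edge e v \<in> nodes" "half_edge e v \<notin> R" using vW by (simp_all add: half_edge_def)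
      have an: "?a \<in> nodes" using hv partner_in_nodes by blast
      have "?a \<notin> R" using vW(2)[of "snd ?a"] nodes_eq[OF an] by simp
      then have "?a \<in> ?A" using an hv uR node_adj_edge[OF e] by auto
      then have "fst ?a \<in> fst ` ?A" by (rule imageI)
      then show ?thesis by simp
    qed
  qed
  then have "epsilon X B W \<subseteq> fst ` ?A" by blast
  then have "card (epsilon X B W) \<le> card ?A"
    using finite_V by (intro surj_card_le) auto
  also have "\<dots> \<le> card (?S q)"
    unfolding R_def by (rule card_boundary_le[OF maximum_partner[OF clean] q]) auto
  finally show ?thesis
    using disjoint_paths_of_maximum[OF q, of Y] \<open>Y \<subseteq> W\<close> W_def by (metis (no_types, lifting) le_trans mem_Collect_eq subsetI)
qed

end

end

section \<open>The easy inequality, and the conclusion\<close>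

lemma path_prefix:
  assumes "is_path B (vs, es)" "i \<le> length es"
  shows "is_path B (take (Suc i) vs, take i es)"
proof -
  have "set (take (Suc i) vs) \<subseteq> set vs" "set (take i es) \<subseteq> set es" by (simp_all add: set_take_subset)
  then show ?thesis using assms unfolding is_path_def by (auto simp: min_def)
qed

text \<open>The prefix up to the first vertex in \<open>W\<close> is a witness for membership in
  \<open>epsilon\<close>.\<close>

lemma set_path_meets_epsilon:
  assumes P: "set_path B X Y P" and "Y \<subseteq> W"
  shows "\<exists>v \<in> path_verts P. v \<in> epsilon X B W"
proof -
  obtain vs es where Pe: "P = (vs, es)" by (cases P)
  have path: "is_path B (vs, es)" and X1: "set vs \<inter> X = {hd vs}" and Y1: "last vs \<in> Y"
    using P by (auto simp: Pe set_path_def path_verts_def first_vert_def last_vert_def)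
  have len: "length vs = Suc (length es)" and dist: "distinct vs" using path by (auto simp: is_path_def)
  have vl: "last vs = vs ! length es" using len by (simp add: last_conv_nth flip: length_0_conv)
  define i where "i = (LEAST i. vs ! i \<in> W)"
  have last: "vs ! length es \<in> W" using Y1 vl assms(2) by auto
  have iW: "vs ! i \<in> W" unfolding i_def using last by (rule LeastI[of "\<lambda>i. vs ! i \<in> W"])
  have i: "i \<le> length es" unfolding i_def using last by (rule Least_le[of "\<lambda>i. vs ! i \<in> W"])
  have least: "vs ! j \<notin> W" if "j < i" for j using that not_less_Least unfolding i_def by blast
  let ?Q = "(take (Suc i) vs, take i es)"
  have tk: "take (Suc i) vs = take i vs @ [vs ! i]" using i len by (simp add: take_Suc_conv_app_nth)
  have "last (take (Suc i) vs) = vs ! i" using tk by simp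
  moreover have "hd (take (Suc i) vs) = hd vs" by simp
  moreover have "hd vs \<in> set (take (Suc i) vs)" using len by (cases vs) auto
  moreover have "set (take (Suc i) vs) \<subseteq> set vs" by (rule set_take_subset)
  ultimately have "set_path B X {vs ! i} ?Q"
    using path_prefix[OF path i] X1 tk
    by (auto simp: set_path_def path_verts_def first_vert_def last_vert_def)
  moreover have "trivial_path ?Q \<or> second_to_last_vert ?Q \<notin> W"
  proof (cases i)
    case (Suc j)
    then have "take i vs = take j vs @ [vs ! j]" using i len by (simp add: take_Suc_conv_app_nth)
    then have "second_to_last_vert ?Q = vs ! j" unfolding second_to_last_vert_def tk by (simp add: butlast_append)
    then show ?thesis using least Suc by simp
  qed (simp add: trivial_path_def)
  ultimately have "vs ! i \<in> epsilon X B W" using iW by (auto simp: epsilon_def)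
  moreover have "vs ! i \<in> path_verts P" using i len by (simp add: Pe path_verts_def)
  ultimately show ?thesis by blast
qed

lemma card_disjoint_paths_le:
  assumes "disjoint_set_paths B X Y \<P>" "Y \<subseteq> W" "finite W"
  shows "card \<P> \<le> card (epsilon X B W)"
proof -
  have "\<forall>P\<in>\<P>. \<exists>v. v \<in> path_verts P \<and> v \<in> epsilon X B W"
    using set_path_meets_epsilon[OF _ assms(2)] assms(1) by (fastforce simp: disjoint_set_paths_def)
  from bchoice[OF this] obtain f where f: "\<forall>P\<in>\<P>. f P \<in> path_verts P \<and> f P \<in> epsilon X B W" ..
  have "inj_on f \<P>"
    using f assms(1) unfolding disjoint_set_paths_def by (intro inj_onI) (metis disjoint_iff)
  moreover have "finite (epsilon X B W)" using assms(3) by (simp add: epsilon_def)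
  ultimately show ?thesis using f by (intro card_inj_on_le) auto
qed

theorem corollary7p11:
  fixes B :: "('v, 'e) bidigraph" and X Y :: "'v set"
  assumes "finite_bidirected_graph B"
    and "X \<subseteq> verts B" and "Y \<subseteq> verts B"
    and "\<not> (\<exists>P. is_path B P \<and> \<not> trivial_path P \<and> first_vert P \<in> X \<and> last_vert P \<in> X)"
  shows "Max {card \<P> | \<P>. disjoint_set_paths B X Y \<P>} =
         Min {card (epsilon X B W) | W. Y \<subseteq> W \<and> W \<subseteq> verts B}"
proof -
  interpret bidigraph_source B X using assms by unfold_locales
  have clean using assms(4) by (simp add: clean_def)
  let ?C = "{card \<P> | \<P>. disjoint_set_paths B X Y \<P>}"
    and ?D = "{card (epsilon X B W) | W. Y \<subseteq> W \<and> W \<subseteq> verts B}"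
  have fin: "finite (verts B)" using assms(1) by (simp add: finite_bidirected_graph_def)
  have le: "c \<le> d" if "c \<in> ?C" "d \<in> ?D" for c d
    using that card_disjoint_paths_le finite_subset[OF _ fin] by blast
  obtain W \<P> where W: "Y \<subseteq> W" "W \<subseteq> verts B" and \<P>: "disjoint_set_paths B X Y \<P>"
    and card: "card (epsilon X B W) \<le> card \<P>"
    using epsilon_bound[OF \<open>clean\<close> assms(3)] by blast
  have C: "card \<P> \<in> ?C" and D: "card (epsilon X B W) \<in> ?D" using W \<P> by blast+
  have eq: "card (epsilon X B W) = card \<P>" using le[OF C D] card by simp
  \<comment> \<open>\<open>Max\<close> is determined only for finite sets; the easy inequality for
    the chosen \<open>W\<close> bounds \<open>?C\<close>.\<close>
  have "finite ?C" using le[OF _ D] by (intro finite_subset[of ?C "{..card (epsilon X B W)}"]) auto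
  moreover have "finite ?D"
  proof (rule finite_subset)
    show "?D \<subseteq> (\<lambda>W. card (epsilon X B W)) ` Pow (verts B)" by blast
  qed (simp add: fin)
  ultimately show ?thesis using le C D eq
    by (metis (no_types, lifting) Max_eqI Min_eqI)
qed

end
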